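(* Let $s_1$, $s_2$, and $s_3$ be three non-collinear points of a 2-dimensional strictly convex distance function $d$ (that is, three non-collinear points of the plane $\mathbb{R}^2$ with distances measured by $d$). Then the number of points that can have integer distances to all three of $s_1$, $s_2$, and $s_3$ is $O\bigl(d(s_1,s_2)\cdot d(s_1,s_3)\bigr)$.
   Context: A convex distance function on $\mathbb{R}^2$ is defined from a centrally symmetric compact convex body $K\subset\mathbb{R}^2$: $d_K(p,q)$ is the smallest scale factor $s$ such that a copy of $K$, scaled by $s$ and centered at $p$, contains $q$. Equivalently, $d_K(p,q)=\|q-p\|_K$ for the norm whose closed unit ball is $K$. A convex set is strictly convex if its boundary does not contain any line segment, and a strictly convex distance function is a convex distance function defined from a strictly convex set. A point $p$ has integer distances to all three of $s_1,s_2,s_3$ if $d(p,s_1)$, $d(p,s_2)$ and $d(p,s_3)$ are all integers.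
   Formalization: The bound is proved with each distance replaced by its maximum with 1, with one absolute constant; the bare product fails for tiny distances (three close points on a unit circle have its centre at integer distance 1 from all), and for distances at least 1 it is the stated bound. *)

theory Defs
  imports "HOL-Analysis.Analysis"
begin

definition symmetric_convex_body :: "(real^2) set \<Rightarrow> bool" where
  "symmetric_convex_body K \<longleftrightarrow>
     convex K \<and> compact K \<and> interior K \<noteq> {} \<and> (\<forall>x\<in>K. - x \<in> K)"

definition strictly_convex :: "(real^2) set \<Rightarrow> bool" where
  "strictly_convex K \<longleftrightarrow>
     convex K \<and> (\<forall>a b. a \<noteq> b \<longrightarrow> \<not> closed_segment a b \<subseteq> frontier K)"

(* For a symmetric convex body the minimum exists: the origin is interior to K,
   so some scale factor works, and compactness of K makes the set of scale factors closed. *)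
definition convex_dist :: "(real^2) set \<Rightarrow> real^2 \<Rightarrow> real^2 \<Rightarrow> real" where
  "convex_dist K p q = (LEAST s. 0 \<le> s \<and> q \<in> (\<lambda>x. p + s *\<^sub>R x) ` K)"

definition integer_distance_points ::
  "(real^2) set \<Rightarrow> real^2 \<Rightarrow> real^2 \<Rightarrow> real^2 \<Rightarrow> (real^2) set" where
  "integer_distance_points K s1 s2 s3 =
     {p. convex_dist K p s1 \<in> \<int> \<and> convex_dist K p s2 \<in> \<int> \<and> convex_dist K p s3 \<in> \<int>}"

end

theory Submission
  imports Defs
begin

text \<open>
  Let \<open>N\<close> be the norm with unit ball \<open>K\<close>. A point \<open>p\<close> at integer distances from the three sites
  has integer differences \<open>N (s2 - p) - N (s1 - p)\<close> and \<open>N (s3 - p) - N (s1 - p)\<close>. By the triangle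
  inequality these lie between \<open>- N (s2 - s1)\<close> and \<open>N (s2 - s1)\<close>, and between \<open>- N (s3 - s1)\<close> and
  \<open>N (s3 - s1)\<close>, so the pair of differences takes at most a constant times
  \<open>max 1 (N (s2 - s1)) * max 1 (N (s3 - s1))\<close> values. It remains to see that each pair of values is
  attained by boundedly many points, that is, that two ``hyperbola branches'' with a common focus
  and non-collinear foci meet in boundedly many points (lemma \<open>hyperbola_intersection_bound\<close>;
  the bound is 8).

  The prescribed differences can be removed by a linear correction. Since the sites are not
  collinear, some linear \<open>g\<close> has \<open>g (s2 - s1)\<close> and \<open>g (s3 - s1)\<close> equal to them, and then
  \<open>M = N - g\<close> takes the same value \<open>h\<close> at \<open>s1 - p\<close>, \<open>s2 - p\<close>, \<open>s3 - p\<close>. The function \<open>M\<close> is no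
  longer a norm and may be negative, but it is still positively homogeneous and strictly
  subadditive off common rays; these two properties are the locale \<open>strictly_sublinear\<close>.
  Geometrically, \<open>p\<close> is the projection of the apex of a cone whose surface passes through three
  fixed points of space, and \<open>h\<close> is the height of the apex over the plane that they span.

  For \<open>h \<noteq> 0\<close>, dividing by \<open>\<bar>h\<bar>\<close> turns the sites into a triangle inscribed in the curve \<open>M = 1\<close>
  or \<open>M = - 1\<close>, and two points \<open>p\<close>, \<open>q\<close> with heights of the same sign give two homothetic
  triangles inscribed in the same curve. The curve is strictly convex, so the triangles coincide
  (lemma \<open>inscribed_homothety_trivial\<close>) and \<open>p = q\<close>: there is at most one point with \<open>h > 0\<close> and
  at most one with \<open>h < 0\<close>. For \<open>h = 0\<close> the level set is a cone that contains no three distinct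
  rays, so two of the vectors \<open>s1 - p\<close>, \<open>s2 - p\<close>, \<open>s3 - p\<close> lie on one ray
  (lemma \<open>null_vectors_share_ray\<close>). Which two, and which of them is the longer, determines \<open>p\<close>
  (lemma \<open>null_point_unique\<close>); this gives at most six further points.
\<close>

section \<open>Strictly sublinear functions\<close>

locale strictly_sublinear =
  fixes M :: "'a::real_vector \<Rightarrow> real"
  assumes scale: "0 \<le> c \<Longrightarrow> M (c *\<^sub>R x) = c * M x"
    and strict: "\<lbrakk>x \<noteq> 0; y \<noteq> 0; \<And>c. 0 < c \<Longrightarrow> y \<noteq> c *\<^sub>R x\<rbrakk> \<Longrightarrow> M (x + y) < M x + M y"
begin

lemma zero [simp]: "M 0 = 0"
  using scale[of 0 0] by simp

lemma subadd: "M (x + y) \<le> M x + M y"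
proof (cases "x = 0 \<or> y = 0 \<or> (\<exists>c>0. y = c *\<^sub>R x)")
  case True
  moreover have "M (x + c *\<^sub>R x) = M x + M (c *\<^sub>R x)" if "0 < c" for c
    using scale[of "1 + c" x] scale[of c x] that by (simp add: algebra_simps)
  ultimately show ?thesis by auto
next
  case False
  then show ?thesis using strict[of x y] by force
qed

lemma sublinear2:
  assumes "0 \<le> a" "0 \<le> b"
  shows "M (a *\<^sub>R x + b *\<^sub>R y) \<le> a * M x + b * M y"
  using subadd[of "a *\<^sub>R x" "b *\<^sub>R y"] assms by (simp add: scale)

text \<open>
  This is the only form in which strict convexity of the level set \<open>M = c\<close> enters the study of
  inscribed triangles: a point of the curve that is a weighted mean of points of the curve equals
  each of them that has positive weight. The total weight \<open>b\<close> need not be 1, and \<open>r\<close> collects the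
  remaining terms of the mean, for which subadditivity gives the required bound. Both
  signs of \<open>c\<close> occur below, so nothing here relies on the region \<open>M \<le> c\<close> being bounded.
\<close>

lemma level_point_extreme:
  assumes Mx: "M x = c" and Mz: "M z = c" and c: "c \<noteq> 0"
    and a: "0 < a" and b: "0 < b"
    and comb: "b *\<^sub>R z = a *\<^sub>R x + r" and r: "M r \<le> (b - a) * c"
  shows "z = x"
proof -
  have "\<exists>k\<ge>0. r = k *\<^sub>R x"
  proof (rule ccontr)
    assume no: "\<not> ?thesis"
    have x0: "x \<noteq> 0" using Mx c by auto
    have r0: "r \<noteq> 0" using no by force
    have "r \<noteq> k *\<^sub>R (a *\<^sub>R x)" if "0 < k" for k
      using no a that by (metis less_eq_real_def mult_pos_pos scaleR_scaleR)
    then have "M (a *\<^sub>R x + r) < M (a *\<^sub>R x) + M r"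
      using strict[of "a *\<^sub>R x" r] x0 r0 a by simp
    then have "b * c < a * c + (b - a) * c"
      using r scale[of b z] scale[of a x] a b comb Mx Mz by simp
    then show False by (simp add: algebra_simps)
  qed
  then obtain k where k: "0 \<le> k" "r = k *\<^sub>R x" by blast
  have eq: "b *\<^sub>R z = (a + k) *\<^sub>R x" using comb k by (simp add: algebra_simps)
  have "b * c = (a + k) * c"
    using arg_cong[OF eq, of M] scale[of b z] scale[of "a + k" x] a b k Mx Mz by simp
  then have "b = a + k" using c by simp
  then show ?thesis using eq b by simp
qed

section \<open>Homothetic triangles inscribed in a level set\<close>

text \<open>
  The triangle \<open>x1\<close>, \<open>x2\<close>, \<open>x3\<close> and its image under \<open>x \<mapsto> l x + w\<close> are both inscribed in
  \<open>M = c\<close>. If the homothety is not the identity, one of the six vertices is a weighted mean of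
  others. Which one depends on the signs of the coordinates \<open>w1\<close>, \<open>w2\<close>, \<open>w3\<close> of \<open>w\<close> with
  respect to the triangle; they are chosen with sum \<open>1 - l\<close> so that the coordinates of each image
  vertex have sum 1. The next three lemmas treat one sign pattern each, up to permutation
  of the vertices.
\<close>

context
  fixes x1 x2 x3 w :: 'a and l c w1 w2 w3 :: real
  assumes c: "c \<noteq> 0" and l: "0 < l"
    and x: "M x1 = c" "M x2 = c" "M x3 = c"
    and y: "M (l *\<^sub>R x1 + w) = c" "M (l *\<^sub>R x2 + w) = c" "M (l *\<^sub>R x3 + w) = c"
    and distinct: "x1 \<noteq> x2" "x1 \<noteq> x3" "x2 \<noteq> x3"
    and w: "w = w1 *\<^sub>R x1 + w2 *\<^sub>R x2 + w3 *\<^sub>R x3" and w_sum: "w1 + w2 + w3 = 1 - l"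
begin

text \<open>
  Each image vertex is here a convex combination of \<open>x1\<close>, \<open>x2\<close>, \<open>x3\<close> with a positive weight on
  its own preimage, so it has to equal that preimage; a homothety fixing two points is the identity.
\<close>

lemma homothety_no_negative:
  assumes "0 \<le> w1" "0 \<le> w2" "0 \<le> w3"
  shows "l = 1 \<and> w = 0"
proof -
  have s: "w3 = 1 - l - w1 - w2" using w_sum by simp
  have "l *\<^sub>R x1 + w = x1"
  proof (rule level_point_extreme[OF x(1) y(1) c, of "l + w1" 1])
    show "1 *\<^sub>R (l *\<^sub>R x1 + w) = (l + w1) *\<^sub>R x1 + (w2 *\<^sub>R x2 + w3 *\<^sub>R x3)"
      unfolding w by (simp add: algebra_simps)
    show "M (w2 *\<^sub>R x2 + w3 *\<^sub>R x3) \<le> (1 - (l + w1)) * c"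
      using sublinear2[OF assms(2,3), of x2 x3] x unfolding s by (simp add: algebra_simps)
  qed (use assms l in auto)
  moreover have "l *\<^sub>R x2 + w = x2"
  proof (rule level_point_extreme[OF x(2) y(2) c, of "l + w2" 1])
    show "1 *\<^sub>R (l *\<^sub>R x2 + w) = (l + w2) *\<^sub>R x2 + (w1 *\<^sub>R x1 + w3 *\<^sub>R x3)"
      unfolding w by (simp add: algebra_simps)
    show "M (w1 *\<^sub>R x1 + w3 *\<^sub>R x3) \<le> (1 - (l + w2)) * c"
      using sublinear2[OF assms(1,3), of x1 x3] x unfolding s by (simp add: algebra_simps)
  qed (use assms l in auto)
  moreover have "(l - 1) *\<^sub>R (x1 - x2) = (l *\<^sub>R x1 + w) - (l *\<^sub>R x2 + w) - (x1 - x2)"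
    by (simp add: algebra_simps)
  ultimately have "(l - 1) *\<^sub>R (x1 - x2) = 0" and fix1: "l *\<^sub>R x1 + w = x1"
    by simp_all
  then have "l = 1" using distinct by simp
  then show ?thesis using fix1 by simp
qed

text \<open>
  Here \<open>x3\<close> moves towards the side \<open>x1 x2\<close>. If its image does not cross that side, it is in the
  triangle \<open>x1 x2 x3\<close>; otherwise it is in the convex hull of the side and the image of the side.
\<close>

lemma homothety_one_negative:
  assumes "0 < w1" "0 \<le> w2" "w3 < 0"
  shows False
proof -
  define n where "n = - w3"
  have n: "0 < n" using assms n_def by simp
  have w': "w = w1 *\<^sub>R x1 + w2 *\<^sub>R x2 - n *\<^sub>R x3" using w n_def by simp
  have s: "w1 + w2 = 1 - l + n" using w_sum n_def by simp
  show False
  proof (cases "n \<le> l")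
    case True
    \<comment> \<open>the weights of the image of \<open>x3\<close> are \<open>w1\<close>, \<open>w2\<close>, \<open>l - n\<close>, all nonnegative here\<close>
    have "l *\<^sub>R x3 + w = x1"
    proof (rule level_point_extreme[OF x(1) y(3) c, of w1 1])
      show "1 *\<^sub>R (l *\<^sub>R x3 + w) = w1 *\<^sub>R x1 + (w2 *\<^sub>R x2 + (l - n) *\<^sub>R x3)"
        unfolding w' by (simp add: algebra_simps)
      have "M (w2 *\<^sub>R x2 + (l - n) *\<^sub>R x3) \<le> w2 * c + (l - n) * c"
        using sublinear2[of w2 "l - n" x2 x3] assms True x by simp
      also have "\<dots> = (w2 + (l - n)) * c" by (simp add: algebra_simps)
      also have "w2 + (l - n) = 1 - w1" using s by simp
      finally show "M (w2 *\<^sub>R x2 + (l - n) *\<^sub>R x3) \<le> (1 - w1) * c" .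
    qed (use assms in auto)
    then have wx: "w = x1 - l *\<^sub>R x3" by (simp add: algebra_simps)
    \<comment> \<open>then \<open>x1\<close> lies strictly between \<open>x3\<close> and its own image\<close>
    have "x1 = x3"
    proof (rule level_point_extreme[OF x(3) x(1) c, of l "1 + l"])
      show "(1 + l) *\<^sub>R x1 = l *\<^sub>R x3 + (l *\<^sub>R x1 + w)"
        unfolding wx by (simp add: algebra_simps)
    qed (use l y(1) in auto)
    then show False using distinct by simp
  next
    case False
    \<comment> \<open>Eliminating \<open>x3\<close> between \<open>n x3 = w1 x1 + w2 x2 - w\<close> and the formula for its image writes
      \<open>n (w1 + w2)\<close> times that image as a positive combination of \<open>x1\<close>, \<open>x2\<close> and their images;
      \<open>r\<close> is that combination without the image of \<open>x1\<close>.\<close>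
    define r where "r = ((n - l) * w2) *\<^sub>R (l *\<^sub>R x2 + w) + l *\<^sub>R (w1 *\<^sub>R x1 + w2 *\<^sub>R x2)"
    have n': "n = w1 + w2 + l - 1" using s by simp
    have "l *\<^sub>R x3 + w = l *\<^sub>R x1 + w"
    proof (rule level_point_extreme[OF y(1) y(3) c, of "(n - l) * w1" "n * (w1 + w2)"])
      have "n *\<^sub>R x3 = w1 *\<^sub>R x1 + w2 *\<^sub>R x2 - w" using w' by simp
      then have "(n * (w1 + w2)) *\<^sub>R (l *\<^sub>R x3 + w)
          = ((w1 + w2) * l) *\<^sub>R (w1 *\<^sub>R x1 + w2 *\<^sub>R x2 - w) + (n * (w1 + w2)) *\<^sub>R w"
        by (metis (no_types, lifting) mult.commute scaleR_right_distrib scaleR_scaleR)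
      also have "\<dots> = ((w1 + w2) * l) *\<^sub>R (w1 *\<^sub>R x1 + w2 *\<^sub>R x2) + ((w1 + w2) * (n - l)) *\<^sub>R w"
        by (simp add: algebra_simps)
      also have "\<dots> = ((n - l) * w1) *\<^sub>R (l *\<^sub>R x1 + w) + r"
      proof -
        have e: "(w1 + w2) * l = l * (n - l) + l"
          unfolding s by (simp add: algebra_simps)
        show ?thesis unfolding e r_def by (simp add: algebra_simps)
      qed
      finally show "(n * (w1 + w2)) *\<^sub>R (l *\<^sub>R x3 + w) = ((n - l) * w1) *\<^sub>R (l *\<^sub>R x1 + w) + r" .
      have "M r \<le> ((n - l) * w2) * c + l * M (w1 *\<^sub>R x1 + w2 *\<^sub>R x2)"
        unfolding r_def using sublinear2 y(2) False assms l by (metis diff_ge_0_iff_ge less_imp_le linear mult_nonneg_nonneg)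
      also have "\<dots> \<le> ((n - l) * w2) * c + l * (w1 * c + w2 * c)"
        using sublinear2[of w1 w2 x1 x2] assms l x by simp
      also have "\<dots> = (n * (w1 + w2) - (n - l) * w1) * c"
        by (simp add: algebra_simps)
      finally show "M r \<le> (n * (w1 + w2) - (n - l) * w1) * c" .
    qed (use assms n False in auto)
    then show False using l distinct by simp
  qed
qed

text \<open>
  The image of \<open>x1\<close> lies beyond the corner \<open>x1\<close>, so \<open>x1\<close> itself is in the triangle formed by that
  image, \<open>x2\<close> and \<open>x3\<close>.
\<close>

lemma homothety_two_negative:
  assumes "w2 < 0" "w3 < 0"
  shows False
proof -
  have s: "w1 = 1 - l - w2 - w3" using w_sum by simp
  have "x1 = x2"
  proof (rule level_point_extreme[OF x(2) x(1) c, of "- w2" "l + w1"])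
    show "(l + w1) *\<^sub>R x1 = (- w2) *\<^sub>R x2 + (1 *\<^sub>R (l *\<^sub>R x1 + w) + (- w3) *\<^sub>R x3)"
      unfolding w by (simp add: algebra_simps)
    show "M (1 *\<^sub>R (l *\<^sub>R x1 + w) + (- w3) *\<^sub>R x3) \<le> (l + w1 - - w2) * c"
      using sublinear2[of 1 "- w3" "l *\<^sub>R x1 + w" x3] assms x y unfolding s
      by (simp add: algebra_simps)
  qed (use assms s in auto)
  then show False using distinct by simp
qed

end

section \<open>The zero level\<close>

text \<open>
  On different rays the combination would have a negative value, but \<open>M\<close> is nonnegative on the
  whole line through a null vector: \<open>M (- z) \<ge> - M z\<close>. The factor \<open>k\<close> has arbitrary sign, so the
  lemma also excludes opposite rays (\<open>k = 0\<close>).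
\<close>

lemma same_ray_if_combination_null:
  assumes null: "M x = 0" "M y = 0" "M z = 0" and nz: "x \<noteq> 0" "y \<noteq> 0"
    and pos: "0 < a" "0 < b" and comb: "a *\<^sub>R x + b *\<^sub>R y = k *\<^sub>R z"
  shows "\<exists>r>0. y = r *\<^sub>R x"
proof (rule ccontr)
  assume no: "\<not> ?thesis"
  have "b *\<^sub>R y \<noteq> r *\<^sub>R (a *\<^sub>R x)" if "0 < r" for r
  proof
    assume "b *\<^sub>R y = r *\<^sub>R (a *\<^sub>R x)"
    then have "(1 / b) *\<^sub>R (b *\<^sub>R y) = (1 / b) *\<^sub>R (r *\<^sub>R (a *\<^sub>R x))" by simp
    then have "y = (r * a / b) *\<^sub>R x" using pos by simp
    moreover have "0 < r * a / b" using pos that by simp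
    ultimately show False using no by blast
  qed
  then have "M (a *\<^sub>R x + b *\<^sub>R y) < M (a *\<^sub>R x) + M (b *\<^sub>R y)"
    using strict[of "a *\<^sub>R x" "b *\<^sub>R y"] nz pos by simp
  then have neg: "M (k *\<^sub>R z) < 0"
    using comb null pos by (simp add: scale)
  moreover have "0 \<le> M (k *\<^sub>R z)"
  proof (cases "0 \<le> k")
    case False
    then show ?thesis
      using subadd[of "k *\<^sub>R z" "(- k) *\<^sub>R z"] scale[of "- k" z] null by simp
  qed (simp add: scale null)
  ultimately show False by simp
qed

text \<open>
  The hypotheses on \<open>t\<close> and \<open>t'\<close> say that \<open>a - p\<close> and \<open>a - q\<close> are positive multiples of
  \<open>e = a - b\<close>. Hence \<open>p\<close> and \<open>q\<close> differ by a multiple of the null vector \<open>e\<close>, and moving \<open>c - p\<close> in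
  the direction \<open>e\<close> strictly decreases \<open>M\<close> because \<open>c\<close> is off the line \<open>a b\<close>.
\<close>

lemma null_point_unique:
  assumes indep: "\<And>k. c - a \<noteq> k *\<^sub>R (a - b)"
    and p: "M (a - p) = 0" "M (c - p) = 0" "b - p = t *\<^sub>R (a - p)" "t < 1"
    and q: "M (a - q) = 0" "M (c - q) = 0" "b - q = t' *\<^sub>R (a - q)" "t' < 1"
  shows "p = q"
proof -
  define e where "e = a - b"
  have on_line: "a - r = (1 / (1 - s)) *\<^sub>R e" if "b - r = s *\<^sub>R (a - r)" "s < 1" for r s
  proof -
    have "e = (a - r) - (b - r)" unfolding e_def by simp
    also have "\<dots> = (1 - s) *\<^sub>R (a - r)" unfolding that(1) by (simp add: algebra_simps)
    finally show ?thesis using that(2) by simp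
  qed
  define u where "u = 1 / (1 - t)"
  define v where "v = 1 / (1 - t')"
  have ap: "a - p = u *\<^sub>R e" and aq: "a - q = v *\<^sub>R e"
    unfolding u_def v_def using on_line p(3,4) q(3,4) by blast+
  have u: "0 < u" unfolding u_def using p(4) by simp
  have Me: "M e = 0" using scale[of u e] u p(1) ap by simp
  have off_line: "x \<noteq> k *\<^sub>R e" if "x = c - a + m *\<^sub>R e" for x m k
  proof
    assume "x = k *\<^sub>R e"
    then have "c - a = (k - m) *\<^sub>R e" using that by (simp add: algebra_simps)
    then show False using indep unfolding e_def by blast
  qed
  show ?thesis
  proof (cases "e = 0")
    case True
    then show ?thesis using ap aq by simp
  next
    case e0: False
    have no_shift: False if "M x = 0" "M (x + g *\<^sub>R e) = 0" "0 < g" "\<And>k. x \<noteq> k *\<^sub>R e" for x g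
    proof -
      have "x \<noteq> 0" using that(4)[of 0] by simp
      moreover have "g *\<^sub>R e \<noteq> r *\<^sub>R x" if "0 < r" for r
      proof
        assume "g *\<^sub>R e = r *\<^sub>R x"
        then have "(1 / r) *\<^sub>R (r *\<^sub>R x) = (1 / r) *\<^sub>R (g *\<^sub>R e)" by simp
        then have "x = (g / r) *\<^sub>R e" using \<open>0 < r\<close> by simp
        then show False using \<open>\<And>k. x \<noteq> k *\<^sub>R e\<close> by blast
      qed
      ultimately have "M (x + g *\<^sub>R e) < M x + M (g *\<^sub>R e)"
        using strict[of x "g *\<^sub>R e"] e0 that(3) by simp
      then show False using that Me by (simp add: scale)
    qed
    have cp: "c - p = c - a + u *\<^sub>R e" and cq: "c - q = c - a + v *\<^sub>R e"
      using ap aq by (simp_all add: algebra_simps)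
    have shift: "c - p + (v - u) *\<^sub>R e = c - q" "c - q + (u - v) *\<^sub>R e = c - p"
      unfolding cp cq by (simp_all add: algebra_simps)
    have "\<not> u < v"
      using no_shift[of "c - p" "v - u", OF p(2) _ _ off_line[OF cp]] q(2) unfolding shift by auto
    moreover have "\<not> v < u"
      using no_shift[of "c - q" "u - v", OF q(2) _ _ off_line[OF cq]] p(2) unfolding shift by auto
    ultimately have "a - p = a - q" unfolding ap aq by simp
    then show ?thesis by simp
  qed
qed

end

section \<open>Coordinates in the plane\<close>

definition det2 :: "real^2 \<Rightarrow> real^2 \<Rightarrow> real" where
  "det2 x y = x $ 1 * y $ 2 - x $ 2 * y $ 1"

lemma det2_cramer: "det2 x y *\<^sub>R z = det2 z y *\<^sub>R x + det2 x z *\<^sub>R y"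
  by (simp add: vec_eq_iff forall_2 det2_def algebra_simps)

lemma det2_basis:
  assumes "det2 x y \<noteq> 0"
  obtains a b where "z = a *\<^sub>R x + b *\<^sub>R y"
proof
  show "z = (det2 z y / det2 x y) *\<^sub>R x + (det2 x z / det2 x y) *\<^sub>R y"
    using arg_cong[OF det2_cramer[of x y z], of "\<lambda>v. (1 / det2 x y) *\<^sub>R v"] assms
    by (simp add: scaleR_add_right)
qed

lemma det2_eq_0_parallel:
  assumes "det2 x y = 0" "x \<noteq> 0"
  obtains c where "y = c *\<^sub>R x"
proof -
  consider "x $ 1 \<noteq> 0" | "x $ 2 \<noteq> 0"
    using assms(2) by (auto simp: vec_eq_iff forall_2)
  then show thesis
  proof cases
    case 1
    then have "y = (y $ 1 / x $ 1) *\<^sub>R x"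
      using assms(1) by (simp add: vec_eq_iff forall_2 det2_def field_simps)
    then show thesis by (rule that)
  next
    case 2
    then have "y = (y $ 2 / x $ 2) *\<^sub>R x"
      using assms(1) by (simp add: vec_eq_iff forall_2 det2_def field_simps)
    then show thesis by (rule that)
  qed
qed

lemma det2_scale: "det2 (c *\<^sub>R x) (d *\<^sub>R y) = c * d * det2 x y"
  by (simp add: det2_def algebra_simps)

lemma det2_noncollinear:
  assumes "\<not> collinear {a, b, c}"
  shows "det2 (b - a) (c - a) \<noteq> 0"
proof
  assume "det2 (b - a) (c - a) = 0"
  then have "b - a = 0 \<or> (\<exists>k. c - a = k *\<^sub>R (b - a))"
    using det2_eq_0_parallel by metis
  then have "collinear {0, b - a, c - a}"
    unfolding collinear_lemma by blast
  then show False using assms collinear_3[of b a c] by (simp add: insert_commute)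
qed

lemma linear_interpolation:
  assumes "det2 x y \<noteq> 0"
  obtains g :: "real^2 \<Rightarrow> real" where "linear g" "g x = a" "g y = b"
proof
  let ?g = "\<lambda>z. (det2 z y * a + det2 x z * b) / det2 x y"
  have add: "det2 (u + v) y = det2 u y + det2 v y" "det2 x (u + v) = det2 x u + det2 x v" for u v
    by (simp_all add: det2_def algebra_simps)
  have scale: "det2 (c *\<^sub>R u) y = c * det2 u y" "det2 x (c *\<^sub>R u) = c * det2 x u" for c u
    by (simp_all add: det2_def algebra_simps)
  show "linear ?g"
    by (rule linearI) (simp_all add: add scale add_divide_distrib distrib_right distrib_left)
  show "?g x = a" "?g y = b" using assms by (simp_all add: det2_def)
qed

text \<open>
  Three vectors in the plane satisfy a nontrivial linear relation. Either two of its coefficients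
  have the same strict sign, and strictness puts the corresponding vectors on one ray, or it already
  makes one vector a positive multiple of another.
\<close>

lemma null_vectors_share_ray:
  fixes M :: "real^2 \<Rightarrow> real"
  assumes M: "strictly_sublinear M"
    and null: "M x = 0" "M y = 0" "M z = 0" and nz: "x \<noteq> 0" "y \<noteq> 0" "z \<noteq> 0"
  shows "(\<exists>r>0. y = r *\<^sub>R x) \<or> (\<exists>r>0. z = r *\<^sub>R x) \<or> (\<exists>r>0. z = r *\<^sub>R y)"
proof -
  note ray = strictly_sublinear.same_ray_if_combination_null[OF M]
  show ?thesis
  proof (cases "det2 x y = 0")
    case True
    then obtain c where c: "y = c *\<^sub>R x" using det2_eq_0_parallel nz by metis
    have "c \<noteq> 0" using c nz by auto
    then consider "0 < c" | "c < 0" by linarith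
    then show ?thesis
    proof cases
      case 2
      then show ?thesis using ray[of x y z "- c" 1 0] null nz c by simp
    qed (use c in blast)
  next
    case False
    then obtain a b where z: "z = a *\<^sub>R x + b *\<^sub>R y" by (rule det2_basis)
    consider "0 < a" "0 < b" | "a < 0" | "b < 0" | "a = 0" "0 < b" | "b = 0" "0 < a" | "a = 0" "b = 0"
      by linarith
    then show ?thesis
    proof cases
      case 1
      have "a *\<^sub>R x + b *\<^sub>R y = 1 *\<^sub>R z" unfolding z by simp
      then show ?thesis using ray[OF null(1,2,3) nz(1,2) 1] by blast
    next
      case 2
      have "(- a) *\<^sub>R x + 1 *\<^sub>R z = b *\<^sub>R y" unfolding z by simp
      then show ?thesis using ray[OF null(1,3,2) nz(1,3)] 2 by (metis neg_0_less_iff_less zero_less_one)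
    next
      case 3
      have "(- b) *\<^sub>R y + 1 *\<^sub>R z = a *\<^sub>R x" unfolding z by simp
      then show ?thesis using ray[OF null(2,3,1) nz(2,3)] 3 by (metis neg_0_less_iff_less zero_less_one)
    next
      case 4
      then have "z = b *\<^sub>R y" unfolding z by simp
      then show ?thesis using 4 by blast
    next
      case 5
      then have "z = a *\<^sub>R x" unfolding z by simp
      then show ?thesis using 5 by blast
    next
      case 6
      then have "z = 0" unfolding z by simp
      then show ?thesis using nz by simp
    qed
  qed
qed

section \<open>Points equidistant from three sites\<close>

text \<open>
  The larger triangle is taken as the original one, so that the coordinates of \<open>w\<close> have the
  nonnegative sum \<open>1 - l\<close>. This excludes the one sign pattern not treated above, where a single
  coordinate is negative and the other two vanish.
\<close>

lemma inscribed_homothety_trivial: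
  fixes M :: "real^2 \<Rightarrow> real"
  assumes M: "strictly_sublinear M" and c: "c \<noteq> 0" and l: "0 < l" "l \<le> 1"
    and x: "M x1 = c" "M x2 = c" "M x3 = c"
    and y: "M (l *\<^sub>R x1 + w) = c" "M (l *\<^sub>R x2 + w) = c" "M (l *\<^sub>R x3 + w) = c"
    and nondeg: "det2 (x2 - x1) (x3 - x1) \<noteq> 0"
  shows "l = 1 \<and> w = 0"
proof -
  obtain w2 w3 where "w - (1 - l) *\<^sub>R x1 = w2 *\<^sub>R (x2 - x1) + w3 *\<^sub>R (x3 - x1)"
    using det2_basis[OF nondeg] .
  then obtain w1 where w: "w = w1 *\<^sub>R x1 + w2 *\<^sub>R x2 + w3 *\<^sub>R x3" and s: "w1 + w2 + w3 = 1 - l"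
    by (auto simp: algebra_simps intro!: that[of "1 - l - w2 - w3"])
  have d: "x1 \<noteq> x2" "x1 \<noteq> x3" "x2 \<noteq> x3" using nondeg by (auto simp: det2_def)
  note none = strictly_sublinear.homothety_no_negative[OF M c l(1)]
    and one = strictly_sublinear.homothety_one_negative[OF M c l(1)]
    and two = strictly_sublinear.homothety_two_negative[OF M c l(1)]
  have perms: "w = w2 *\<^sub>R x2 + w1 *\<^sub>R x1 + w3 *\<^sub>R x3" "w = w1 *\<^sub>R x1 + w3 *\<^sub>R x3 + w2 *\<^sub>R x2"
    "w = w3 *\<^sub>R x3 + w1 *\<^sub>R x1 + w2 *\<^sub>R x2" "w = w2 *\<^sub>R x2 + w3 *\<^sub>R x3 + w1 *\<^sub>R x1"
    "w = w3 *\<^sub>R x3 + w2 *\<^sub>R x2 + w1 *\<^sub>R x1"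
    "w2 + w1 + w3 = 1 - l" "w1 + w3 + w2 = 1 - l" "w3 + w1 + w2 = 1 - l"
    "w2 + w3 + w1 = 1 - l" "w3 + w2 + w1 = 1 - l"
    using w s by simp_all
  have no2: "\<not> (w2 < 0 \<and> w3 < 0)" "\<not> (w1 < 0 \<and> w3 < 0)" "\<not> (w1 < 0 \<and> w2 < 0)"
    using two[OF x(1,2,3) y(1,2,3) d(1) d(2) d(3) w s]
      two[OF x(2,1,3) y(2,1,3) d(1)[symmetric] d(3) d(2) perms(1,6)]
      two[OF x(3,1,2) y(3,1,2) d(2)[symmetric] d(3)[symmetric] d(1) perms(3,8)]
    by blast+
  have no1: "\<not> (0 < w1 \<and> 0 \<le> w2 \<and> w3 < 0)" "\<not> (0 < w2 \<and> 0 \<le> w1 \<and> w3 < 0)"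
    "\<not> (0 < w1 \<and> 0 \<le> w3 \<and> w2 < 0)" "\<not> (0 < w3 \<and> 0 \<le> w1 \<and> w2 < 0)"
    "\<not> (0 < w2 \<and> 0 \<le> w3 \<and> w1 < 0)" "\<not> (0 < w3 \<and> 0 \<le> w2 \<and> w1 < 0)"
    using one[OF x(1,2,3) y(1,2,3) d(1) d(2) d(3) w s]
      one[OF x(2,1,3) y(2,1,3) d(1)[symmetric] d(3) d(2) perms(1,6)]
      one[OF x(1,3,2) y(1,3,2) d(2) d(1) d(3)[symmetric] perms(2,7)]
      one[OF x(3,1,2) y(3,1,2) d(2)[symmetric] d(3)[symmetric] d(1) perms(3,8)]
      one[OF x(2,3,1) y(2,3,1) d(3) d(1)[symmetric] d(2)[symmetric] perms(4,9)]
      one[OF x(3,2,1) y(3,2,1) d(3)[symmetric] d(2)[symmetric] d(1)[symmetric] perms(5,10)]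
    by blast+
  have nonneg: "0 \<le> a"
    if "a + b + c = 1 - l" "\<not> (a < 0 \<and> b < 0)" "\<not> (a < 0 \<and> c < 0)"
      "\<not> (0 < b \<and> 0 \<le> c \<and> a < 0)" "\<not> (0 < c \<and> 0 \<le> b \<and> a < 0)" for a b c
    using that l(2) by argo
  have "0 \<le> w1" "0 \<le> w2" "0 \<le> w3"
    using nonneg[OF s no2(3,2) no1(5,6)] nonneg[OF perms(6) _ no2(1) no1(3,4)]
      nonneg[OF perms(8) _ _ no1(1,2)] no2 by blast+
  then show ?thesis using none[OF x y d w s] by blast
qed

lemma equidistant_point_unique:
  fixes M :: "real^2 \<Rightarrow> real"
  assumes M: "strictly_sublinear M" and c: "c \<noteq> 0"
    and nondeg: "det2 (s2 - s1) (s3 - s1) \<noteq> 0"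
    and p: "0 < h" "M (s1 - p) = h * c" "M (s2 - p) = h * c" "M (s3 - p) = h * c"
    and q: "0 < k" "M (s1 - q) = k * c" "M (s2 - q) = k * c" "M (s3 - q) = k * c"
  shows "p = q"
proof -
  have main: "p = q" if "h \<le> k"
    and p: "0 < h" "M (s1 - p) = h * c" "M (s2 - p) = h * c" "M (s3 - p) = h * c"
    and q: "0 < k" "M (s1 - q) = k * c" "M (s2 - q) = k * c" "M (s3 - q) = k * c"
    for p q h k
  proof -
    let ?x = "\<lambda>s. (1 / h) *\<^sub>R (s - p)"
    have y: "(h / k) *\<^sub>R ?x s + (1 / k) *\<^sub>R (p - q) = (1 / k) *\<^sub>R (s - q)" for s
      using \<open>0 < h\<close> by (simp add: algebra_simps)
    have diff: "?x s - ?x t = (1 / h) *\<^sub>R (s - t)" for s t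
      by (simp add: algebra_simps)
    note scale = strictly_sublinear.scale[OF M]
    have Mx: "M (?x s) = c" if "M (s - p) = h * c" for s
      using scale[of "1 / h" "s - p"] \<open>0 < h\<close> that by simp
    have My: "M ((h / k) *\<^sub>R ?x s + (1 / k) *\<^sub>R (p - q)) = c" if "M (s - q) = k * c" for s
      unfolding y using scale[of "1 / k" "s - q"] \<open>0 < k\<close> that by simp
    have "det2 (?x s2 - ?x s1) (?x s3 - ?x s1) \<noteq> 0"
      unfolding diff det2_scale using nondeg \<open>0 < h\<close> by simp
    moreover have "0 < h / k" "h / k \<le> 1" using that(1) p(1) q(1) by auto
    ultimately have "h / k = 1 \<and> (1 / k) *\<^sub>R (p - q) = 0"
      using inscribed_homothety_trivial[OF M c _ _ Mx[OF p(2)] Mx[OF p(3)] Mx[OF p(4)]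
          My[OF q(2)] My[OF q(3)] My[OF q(4)]] by blast
    then show "p = q" using \<open>0 < k\<close> by simp
  qed
  show ?thesis
    using main[OF _ p q] main[OF _ q p] by (cases "h \<le> k") auto
qed

lemma finite_card_le_cover:
  assumes "A \<subseteq> \<Union> (set As)" and "\<And>B x y. \<lbrakk>B \<in> set As; x \<in> B; y \<in> B\<rbrakk> \<Longrightarrow> x = y"
  shows "finite A \<and> card A \<le> length As"
  using assms
proof (induction As arbitrary: A)
  case (Cons B As)
  have IH: "finite (A - B) \<and> card (A - B) \<le> length As"
    by (rule Cons.IH) (use Cons.prems in auto)
  have "B \<subseteq> {x}" if "x \<in> B" for x using Cons.prems(2)[of B] that by auto
  then have "\<exists>x. B \<subseteq> {x}" by blast
  then obtain x where "B \<subseteq> {x}" by blast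
  then have "finite B" "card B \<le> 1"
    using finite_subset[of B "{x}"] card_mono[of "{x}" B] by auto
  then have fin: "finite ((A - B) \<union> B)" using IH by blast
  have sub: "A \<subseteq> (A - B) \<union> B" by blast
  have "card A \<le> card (A - B) + card B"
    using card_mono[OF fin sub] card_Un_le[of "A - B" B] by (rule order_trans)
  moreover have "finite A" using fin sub by (rule rev_finite_subset)
  ultimately show ?case using IH \<open>card B \<le> 1\<close> by simp
qed simp

text \<open>
  The eight classes are the two signs of the common value and, at value zero, the ordered pairs of
  sites: \<open>p\<close> belongs to \<open>Z a b\<close> if \<open>a - p\<close> and \<open>b - p\<close> lie on one ray and \<open>a - p\<close> is the longer.
\<close>

lemma equidistant_points_bound:
  fixes M :: "real^2 \<Rightarrow> real"
  assumes M: "strictly_sublinear M" and nondeg: "det2 (s2 - s1) (s3 - s1) \<noteq> 0"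
  defines "E \<equiv> {p. M (s2 - p) = M (s1 - p) \<and> M (s3 - p) = M (s1 - p)}"
  shows "finite E \<and> card E \<le> 8"
proof -
  \<comment> \<open>Negative \<open>t\<close> would put \<open>a - p\<close> and \<open>b - p\<close> on opposite rays, which strictness rules out, and
    \<open>t = 0\<close> is the case where \<open>p\<close> is the site \<open>b\<close>; so \<open>t < 1\<close> is all that has to be recorded.\<close>
  define Z where "Z a b = {p. M (s1 - p) = 0 \<and> M (s2 - p) = 0 \<and> M (s3 - p) = 0 \<and>
    (\<exists>t<1. b - p = t *\<^sub>R (a - p))}" for a b
  define As where "As = [{p \<in> E. 0 < M (s1 - p)}, {p \<in> E. M (s1 - p) < 0},
    Z s1 s2, Z s2 s1, Z s1 s3, Z s3 s1, Z s2 s3, Z s3 s2]"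
  have sep: "b - a \<noteq> 0"
    if "(a, b) \<in> {(s1, s2), (s2, s1), (s1, s3), (s3, s1), (s2, s3), (s3, s2)}" for a b
    using nondeg that by (auto simp: det2_def)
  have ordered: "p \<in> Z a b \<or> p \<in> Z b a"
    if "M (s1 - p) = 0" "M (s2 - p) = 0" "M (s3 - p) = 0" "b - a \<noteq> 0"
      and r: "\<exists>r>0. b - p = r *\<^sub>R (a - p)" for a b p
  proof -
    obtain r where r: "0 < r" "b - p = r *\<^sub>R (a - p)" using r by blast
    have "r \<noteq> 1" using r that by auto
    then consider "r < 1" | "1 / r < 1" using r(1) by fastforce
    then show ?thesis
    proof cases
      case 2
      have "a - p = (1 / r) *\<^sub>R (b - p)" using r by simp
      then show ?thesis using 2 that unfolding Z_def by blast
    qed (use r that in \<open>auto simp: Z_def\<close>)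
  qed
  have "p \<in> \<Union> (set As)" if "p \<in> E" for p
  proof (cases "M (s1 - p) = 0")
    case False
    then show ?thesis using that unfolding As_def by auto
  next
    case True
    then have n: "M (s1 - p) = 0" "M (s2 - p) = 0" "M (s3 - p) = 0"
      using that unfolding E_def by auto
    have apex: "p \<in> Z a p" for a using n unfolding Z_def by (auto intro!: exI[of _ 0])
    show ?thesis
    proof (cases "s1 - p = 0 \<or> s2 - p = 0 \<or> s3 - p = 0")
      case True
      then show ?thesis unfolding As_def using apex by auto
    next
      case False
      then show ?thesis
        using null_vectors_share_ray[OF M n] ordered[OF n sep, of s1 s2] ordered[OF n sep, of s1 s3]
          ordered[OF n sep, of s2 s3]
        unfolding As_def by auto
    qed
  qed
  then have cover: "E \<subseteq> \<Union> (set As)" by blast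
  have Z_unique: "p = q" if p: "p \<in> Z a b" and q: "q \<in> Z a b"
    and abc: "(a, b, c) \<in> {(s1, s2, s3), (s2, s1, s3), (s1, s3, s2), (s3, s1, s2), (s2, s3, s1), (s3, s2, s1)}"
    for a b c p q
  proof -
    have "det2 (a - b) (c - a) \<noteq> 0"
      using nondeg abc by (auto simp: det2_def algebra_simps)
    moreover have "det2 (a - b) (k *\<^sub>R (a - b)) = 0" for k by (simp add: det2_def)
    ultimately have indep: "c - a \<noteq> k *\<^sub>R (a - b)" for k by metis
    obtain t where "t < 1" "b - p = t *\<^sub>R (a - p)" using p unfolding Z_def by blast
    moreover obtain t' where "t' < 1" "b - q = t' *\<^sub>R (a - q)" using q unfolding Z_def by blast
    moreover have "M (a - p) = 0" "M (c - p) = 0" "M (a - q) = 0" "M (c - q) = 0"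
      using p q abc unfolding Z_def by auto
    ultimately show ?thesis
      using strictly_sublinear.null_point_unique[OF M indep] by blast
  qed
  have unique: "x = y" if "B \<in> set As" "x \<in> B" "y \<in> B" for B x y
  proof -
    have pos: "x = y" if "x \<in> E" "y \<in> E" "0 < M (s1 - x)" "0 < M (s1 - y)"
      using equidistant_point_unique[OF M _ nondeg, of 1 "M (s1 - x)" x "M (s1 - y)" y] that
      unfolding E_def by simp
    have neg: "x = y" if "x \<in> E" "y \<in> E" "M (s1 - x) < 0" "M (s1 - y) < 0"
      using equidistant_point_unique[OF M _ nondeg, of "- 1" "- M (s1 - x)" x "- M (s1 - y)" y] that
      unfolding E_def by simp
    have Z: "x = y" if "x \<in> Z a b" "y \<in> Z a b"
      "(a, b) \<in> {(s1, s2), (s2, s1), (s1, s3), (s3, s1), (s2, s3), (s3, s2)}" for a b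
      using that(3) Z_unique[OF that(1,2), of s1] Z_unique[OF that(1,2), of s2]
        Z_unique[OF that(1,2), of s3] by auto
    have "B = {p \<in> E. 0 < M (s1 - p)} \<or> B = {p \<in> E. M (s1 - p) < 0} \<or>
      (\<exists>a b. B = Z a b \<and> (a, b) \<in> {(s1, s2), (s2, s1), (s1, s3), (s3, s1), (s2, s3), (s3, s2)})"
      using \<open>B \<in> set As\<close> unfolding As_def by auto
    then show ?thesis using \<open>x \<in> B\<close> \<open>y \<in> B\<close> pos neg Z by blast
  qed
  have "finite E \<and> card E \<le> length As"
    using cover unique by (rule finite_card_le_cover)
  then show ?thesis unfolding As_def by simp
qed

lemma strictly_sublinear_minus_linear:
  assumes N: "strictly_sublinear N" and g: "linear g"
  shows "strictly_sublinear (\<lambda>x. N x - g x)"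
proof
  fix c :: real and x :: 'a
  assume "0 \<le> c"
  then show "N (c *\<^sub>R x) - g (c *\<^sub>R x) = c * (N x - g x)"
    by (simp add: strictly_sublinear.scale[OF N] linear_scale[OF g] algebra_simps)
next
  fix x y :: 'a
  assume "x \<noteq> 0" "y \<noteq> 0" "\<And>c. 0 < c \<Longrightarrow> y \<noteq> c *\<^sub>R x"
  then show "N (x + y) - g (x + y) < N x - g x + (N y - g y)"
    using strictly_sublinear.strict[OF N] by (simp add: linear_add[OF g] algebra_simps)
qed

text \<open>
  Subtracting a linear function that interpolates the two prescribed differences makes the three
  values equal, which reduces the question to points equidistant from the sites with respect to a
  strictly sublinear function.
\<close>

lemma hyperbola_intersection_bound:
  fixes N :: "real^2 \<Rightarrow> real" and a b :: real
  assumes N: "strictly_sublinear N" and nondeg: "det2 (s2 - s1) (s3 - s1) \<noteq> 0"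
  defines "H \<equiv> {p. N (s2 - p) - N (s1 - p) = a \<and> N (s3 - p) - N (s1 - p) = b}"
  shows "finite H \<and> card H \<le> 8"
proof -
  obtain g :: "real^2 \<Rightarrow> real" where g: "linear g" "g (s2 - s1) = a" "g (s3 - s1) = b"
    using linear_interpolation[OF nondeg] .
  let ?M = "\<lambda>x. N x - g x"
  have "g (s2 - p) = g (s1 - p) + a" "g (s3 - p) = g (s1 - p) + b" for p
    using g by (simp_all add: linear_diff)
  then have "H = {p. ?M (s2 - p) = ?M (s1 - p) \<and> ?M (s3 - p) = ?M (s1 - p)}"
    unfolding H_def by auto
  then show ?thesis
    using equidistant_points_bound[OF strictly_sublinear_minus_linear[OF N g(1)] nondeg] by simp
qed

section \<open>The norm of a strictly convex body\<close>

definition body_norm :: "(real^2) set \<Rightarrow> real^2 \<Rightarrow> real" where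
  "body_norm K x = convex_dist K 0 x"

lemma convex_dist_eq_body_norm: "convex_dist K p q = body_norm K (q - p)"
proof -
  have "q \<in> (\<lambda>x. p + s *\<^sub>R x) ` K \<longleftrightarrow> q - p \<in> (\<lambda>x. 0 + s *\<^sub>R x) ` K" for s
    by (auto simp: image_iff algebra_simps)
  then show ?thesis unfolding body_norm_def convex_dist_def by simp
qed

context
  fixes K :: "(real^2) set"
  assumes body: "symmetric_convex_body K"
begin

lemma zero_interior: "0 \<in> interior K"
proof -
  obtain z where z: "z \<in> interior K" using body unfolding symmetric_convex_body_def by blast
  have "uminus ` K = K" using body unfolding symmetric_convex_body_def by force
  then have "interior K = uminus ` interior K" using interior_negations[of K] by simp
  then have "- z \<in> interior K" using z by blast
  moreover have "convex (interior K)" using body unfolding symmetric_convex_body_def by (simp add: convex_interior)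
  ultimately have "(1/2) *\<^sub>R z + (1/2) *\<^sub>R (- z) \<in> interior K" using z by (intro convexD) auto
  then show ?thesis by simp
qed

lemma zero_mem: "0 \<in> K" using zero_interior interior_subset by blast

text \<open>
  For \<open>x \<noteq> 0\<close> the least scale factor is the reciprocal of the largest \<open>t\<close> with \<open>t x \<in> K\<close>; the set of
  these \<open>t\<close> is compact because \<open>K\<close> is, and it contains a positive number because \<open>0\<close> is interior.
\<close>

lemma body_scale_minimum: "\<exists>s. 0 \<le> s \<and> x \<in> (*\<^sub>R) s ` K \<and> (\<forall>t. 0 \<le> t \<and> x \<in> (*\<^sub>R) t ` K \<longrightarrow> s \<le> t)"
proof (cases "x = 0")
  case True
  then show ?thesis using zero_mem by (intro exI[of _ 0]) auto
next
  case False
  define T where "T = {t. 0 \<le> t \<and> t *\<^sub>R x \<in> K}"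
  have K: "closed K" "bounded K"
    using body unfolding symmetric_convex_body_def by (auto simp: compact_imp_closed compact_imp_bounded)
  have "closed T"
  proof -
    have "closed ((\<lambda>t. t *\<^sub>R x) -` K)"
      by (intro closed_vimage K(1) continuous_intros)
    moreover have "T = {0..} \<inter> (\<lambda>t. t *\<^sub>R x) -` K" unfolding T_def by auto
    ultimately show ?thesis by (simp add: closed_Int)
  qed
  moreover have "bounded T"
  proof -
    obtain B where B: "\<And>k. k \<in> K \<Longrightarrow> norm k \<le> B" using K(2) unfolding bounded_iff by blast
    have "norm t \<le> B / norm x" if "t \<in> T" for t
      using B[of "t *\<^sub>R x"] that False unfolding T_def by (simp add: field_simps)
    then show ?thesis unfolding bounded_iff by blast
  qed
  ultimately have "compact T" by (simp add: compact_eq_bounded_closed)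
  obtain e where e: "0 < e" "ball 0 e \<subseteq> K" using zero_interior by (auto simp: mem_interior)
  have pos: "e / (2 * norm x) \<in> T" using e False unfolding T_def by (auto intro!: subsetD[OF e(2)])
  then obtain m where m: "m \<in> T" "\<And>t. t \<in> T \<Longrightarrow> t \<le> m"
    using compact_attains_sup[OF \<open>compact T\<close>] by blast
  have m0: "0 < m" using m(2)[OF pos] e(1) False by (smt (verit) divide_pos_pos zero_less_norm_iff)
  show ?thesis
  proof (intro exI[of _ "1 / m"] conjI allI impI)
    show "0 \<le> 1 / m" using m0 by simp
    show "x \<in> (*\<^sub>R) (1 / m) ` K"
      using m(1) m0 unfolding T_def by (intro image_eqI[of _ _ "m *\<^sub>R x"]) auto
    fix t assume t: "0 \<le> t \<and> x \<in> (*\<^sub>R) t ` K"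
    then obtain k where k: "k \<in> K" "x = t *\<^sub>R k" by blast
    then have "0 < t" using t False by (cases "t = 0") auto
    then have "1 / t \<in> T" using k unfolding T_def by simp
    then have "1 / t \<le> m" by (rule m(2))
    then show "1 / m \<le> t" using m0 \<open>0 < t\<close> by (simp add: field_simps)
  qed
qed

lemma
  shows body_norm_nonneg: "0 \<le> body_norm K x"
    and body_norm_witness: "\<exists>k\<in>K. x = body_norm K x *\<^sub>R k"
    and body_norm_le: "\<lbrakk>0 \<le> s; k \<in> K; x = s *\<^sub>R k\<rbrakk> \<Longrightarrow> body_norm K x \<le> s"
proof -
  obtain s where s: "0 \<le> s" "x \<in> (*\<^sub>R) s ` K" "\<And>t. 0 \<le> t \<and> x \<in> (*\<^sub>R) t ` K \<Longrightarrow> s \<le> t"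
    using body_scale_minimum by blast
  have "body_norm K x = s"
    unfolding body_norm_def convex_dist_def
    by (rule Least_equality) (use s in auto)
  then show "0 \<le> body_norm K x" "\<exists>k\<in>K. x = body_norm K x *\<^sub>R k"
      "\<lbrakk>0 \<le> s; k \<in> K; x = s *\<^sub>R k\<rbrakk> \<Longrightarrow> body_norm K x \<le> s" for s k
    using s by auto
qed

lemma body_norm_eq_0: "body_norm K x = 0 \<Longrightarrow> x = 0"
  using body_norm_witness[of x] by auto

lemma body_norm_scale:
  assumes "0 \<le> c"
  shows "body_norm K (c *\<^sub>R x) = c * body_norm K x"
proof (cases "c = 0")
  case True
  then show ?thesis
    using body_norm_le[of 0 0 0] zero_mem body_norm_nonneg[of 0] by simp
next
  case False
  have le: "body_norm K (c *\<^sub>R x) \<le> c * body_norm K x" if "0 \<le> c" for c x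
  proof -
    obtain k where "k \<in> K" "x = body_norm K x *\<^sub>R k" using body_norm_witness by blast
    then show ?thesis
      using body_norm_le[of "c * body_norm K x" k "c *\<^sub>R x"] that body_norm_nonneg[of x]
      by (metis mult_nonneg_nonneg scaleR_scaleR)
  qed
  have "body_norm K x \<le> (1 / c) * body_norm K (c *\<^sub>R x)"
    using le[of "1 / c" "c *\<^sub>R x"] assms False by simp
  then show ?thesis using le[of c x] assms False by (simp add: field_simps)
qed

lemma body_norm_triangle: "body_norm K (x + y) \<le> body_norm K x + body_norm K y"
proof -
  let ?a = "body_norm K x" and ?b = "body_norm K y"
  show ?thesis
  proof (cases "?a + ?b = 0")
    case True
    then have "?a = 0" "?b = 0" using body_norm_nonneg[of x] body_norm_nonneg[of y] by auto
    then show ?thesis using body_norm_eq_0[of x] by simp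
  next
    case False
    then have pos: "0 < ?a + ?b" using body_norm_nonneg[of x] body_norm_nonneg[of y] by simp
    obtain k l where k: "k \<in> K" "x = ?a *\<^sub>R k" and l: "l \<in> K" "y = ?b *\<^sub>R l"
      using body_norm_witness by metis
    have "(?a / (?a + ?b)) *\<^sub>R k + (?b / (?a + ?b)) *\<^sub>R l \<in> K"
      using body k l pos body_norm_nonneg unfolding symmetric_convex_body_def
      by (intro convexD) (auto simp: add_divide_distrib[symmetric])
    moreover have "x + y = (?a + ?b) *\<^sub>R ((?a / (?a + ?b)) *\<^sub>R k + (?b / (?a + ?b)) *\<^sub>R l)"
      using k l pos by (simp add: scaleR_add_right)
    ultimately show ?thesis using body_norm_le pos by (metis less_imp_le)
  qed
qed

lemma body_norm_minus: "body_norm K (- x) = body_norm K x"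
proof -
  have "body_norm K (- x) \<le> body_norm K x" for x
  proof -
    obtain k where "k \<in> K" "x = body_norm K x *\<^sub>R k" using body_norm_witness by blast
    then show ?thesis
      using body_norm_le[of "body_norm K x" "- k" "- x"] body_norm_nonneg body
      unfolding symmetric_convex_body_def by (metis scaleR_minus_right)
  qed
  from this[of x] this[of "- x"] show ?thesis by simp
qed

lemma unit_sphere_subset_frontier:
  assumes "body_norm K x = 1"
  shows "x \<in> frontier K"
proof -
  have x: "x \<in> K" using body_norm_witness[of x] assms by auto
  have "x \<notin> interior K"
  proof
    assume "x \<in> interior K"
    then obtain e where e: "0 < e" "ball x e \<subseteq> K" by (auto simp: mem_interior)
    have x0: "x \<noteq> 0" using assms body_norm_scale[of 0 0] by auto
    define d where "d = e / (2 * norm x)"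
    have d: "0 < d" unfolding d_def using e x0 by simp
    have "dist x ((1 + d) *\<^sub>R x) = d * norm x"
      using d by (simp add: dist_norm algebra_simps)
    also have "\<dots> < e" unfolding d_def using e x0 by simp
    finally have "(1 + d) *\<^sub>R x \<in> K" using e by auto
    then have "body_norm K x \<le> 1 / (1 + d)"
      using body_norm_le[of "1 / (1 + d)" "(1 + d) *\<^sub>R x" x] d by simp
    then show False using assms d by (simp add: field_simps)
  qed
  then show ?thesis using x closure_subset unfolding frontier_def by blast
qed

text \<open>
  Along a chord of the unit ball the norm is a convex function with value 1 at both ends. If it
  reached 1 at an interior point, it would be constant, and the chord would lie in the frontier.
\<close>

lemma body_norm_segment_less:
  assumes strict: "strictly_convex K"
    and x: "body_norm K x = 1" and y: "body_norm K y = 1" and ne: "x \<noteq> y"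
    and u: "0 < u" "u < 1"
  shows "body_norm K ((1 - u) *\<^sub>R x + u *\<^sub>R y) < 1"
proof (rule ccontr)
  let ?z = "\<lambda>v. (1 - v) *\<^sub>R x + v *\<^sub>R y"
  have comb: "body_norm K (a *\<^sub>R p + b *\<^sub>R q) \<le> a * body_norm K p + b * body_norm K q"
    if "0 \<le> a" "0 \<le> b" for a b p q
    using body_norm_triangle[of "a *\<^sub>R p" "b *\<^sub>R q"] that by (simp add: body_norm_scale)
  assume "\<not> body_norm K (?z u) < 1"
  then have zu: "1 \<le> body_norm K (?z u)" by simp
  have "body_norm K (?z v) = 1" if v: "0 \<le> v" "v \<le> 1" for v
  proof (rule ccontr)
    assume "body_norm K (?z v) \<noteq> 1"
    then have lt: "body_norm K (?z v) < 1"
      using comb[of "1 - v" v x y] v x y by simp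
    consider "v = u" | "v < u" | "u < v" by linarith
    then show False
    proof cases
      case 2
      define a where "a = (1 - u) / (1 - v)"
      have a: "0 < a" "a \<le> 1" "a * (1 - v) = 1 - u" unfolding a_def using u 2 by auto
      have "?z u = a *\<^sub>R ?z v + (1 - a) *\<^sub>R y"
      proof -
        have "a * v + (1 - a) = u" using a(3) by (simp add: algebra_simps)
        then show ?thesis using a(3) by (metis (no_types, lifting) add.assoc scaleR_add_left scaleR_add_right scaleR_scaleR)
      qed
      then have "body_norm K (?z u) \<le> a * body_norm K (?z v) + (1 - a)"
        using comb[of a "1 - a" "?z v" y] a y by simp
      also have "\<dots> < a * 1 + (1 - a)" using lt a by simp
      finally show False using zu by simp
    next
      case 3
      define a where "a = u / v"
      have a: "0 < a" "a \<le> 1" "a * v = u" unfolding a_def using u 3 by auto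
      have "?z u = a *\<^sub>R ?z v + (1 - a) *\<^sub>R x"
      proof -
        have "a * (1 - v) + (1 - a) = 1 - u" using a(3) by (simp add: algebra_simps)
        then show ?thesis using a(3) by (metis (no_types, lifting) add.assoc add.commute scaleR_add_left scaleR_add_right scaleR_scaleR)
      qed
      then have "body_norm K (?z u) \<le> a * body_norm K (?z v) + (1 - a)"
        using comb[of a "1 - a" "?z v" x] a x by simp
      also have "\<dots> < a * 1 + (1 - a)" using lt a by simp
      finally show False using zu by simp
    qed (use lt zu in simp)
  qed
  then have "closed_segment x y \<subseteq> frontier K"
    using unit_sphere_subset_frontier unfolding closed_segment_def by blast
  then show False using strict ne unfolding strictly_convex_def by blast
qed

lemma body_norm_strictly_sublinear:
  assumes strict: "strictly_convex K"
  shows "strictly_sublinear (body_norm K)"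
proof
  show "body_norm K (c *\<^sub>R x) = c * body_norm K x" if "0 \<le> c" for c x
    using that by (rule body_norm_scale)
next
  fix x y :: "real^2"
  assume nz: "x \<noteq> 0" "y \<noteq> 0" and ray: "\<And>c. 0 < c \<Longrightarrow> y \<noteq> c *\<^sub>R x"
  define a where "a = body_norm K x"
  define b where "b = body_norm K y"
  have pos: "0 < a" "0 < b"
    unfolding a_def b_def using nz body_norm_eq_0 body_norm_nonneg by (metis less_eq_real_def)+
  let ?x = "(1 / a) *\<^sub>R x" and ?y = "(1 / b) *\<^sub>R y"
  have ne: "?x \<noteq> ?y"
  proof
    assume "?x = ?y"
    then have "b *\<^sub>R ?x = b *\<^sub>R ?y" by simp
    then have "y = (b / a) *\<^sub>R x" using pos by simp
    then show False using ray[of "b / a"] pos by simp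
  qed
  define u where "u = b / (a + b)"
  have u: "0 < u" "u < 1" "(a + b) * u = b" "(a + b) * (1 - u) = a"
    unfolding u_def using pos by (auto simp: field_simps)
  have "body_norm K ((1 - u) *\<^sub>R ?x + u *\<^sub>R ?y) < 1"
    using body_norm_segment_less[OF strict _ _ ne u(1,2)] pos
    by (simp add: body_norm_scale a_def[symmetric] b_def[symmetric])
  moreover have "x + y = (a + b) *\<^sub>R ((1 - u) *\<^sub>R ?x + u *\<^sub>R ?y)"
    unfolding scaleR_add_right scaleR_scaleR mult.assoc[symmetric] using u pos by simp
  ultimately show "body_norm K (x + y) < body_norm K x + body_norm K y"
    using body_norm_scale[of "a + b"] pos unfolding a_def[symmetric] b_def[symmetric]
    by (metis add_pos_pos less_imp_le mult.right_neutral mult_less_cancel_left_pos)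
qed

lemma body_norm_diff_le: "\<bar>body_norm K x - body_norm K y\<bar> \<le> body_norm K (x - y)"
  using body_norm_triangle[of "x - y" y] body_norm_triangle[of "y - x" x] body_norm_minus[of "x - y"]
  by simp

end

section \<open>Counting pairs of integer differences\<close>

lemma card_symmetric_int_interval:
  assumes "0 \<le> d"
  shows "real (card {- \<lfloor>d\<rfloor>..\<lfloor>d\<rfloor>}) \<le> 3 * max 1 d"
proof -
  have "real (card {- \<lfloor>d\<rfloor>..\<lfloor>d\<rfloor>}) = 2 * of_int \<lfloor>d\<rfloor> + 1"
    using assms by simp
  also have "\<dots> \<le> 3 * max 1 d" using of_int_floor_le[of d] by linarith
  finally show ?thesis .
qed

(* The constant C is absolute.  The maxima with 1 only matter when one of the two distances
   is below 1: with the bare product the bound would fail there, as three arbitrarily close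
   points can still have a point at distance exactly 1 from all of them. *)
theorem theorem1:
  shows "\<exists>C::real. \<forall>K s1 s2 s3.
    symmetric_convex_body K \<and> strictly_convex K \<and> \<not> collinear {s1, s2, s3} \<longrightarrow>
      finite (integer_distance_points K s1 s2 s3) \<and>
      real (card (integer_distance_points K s1 s2 s3))
        \<le> C * (max 1 (convex_dist K s1 s2) * max 1 (convex_dist K s1 s3))"
  \<comment> \<open>at most \<open>3 max 1 d\<close> integers lie in \<open>[- d, d]\<close>, and 72 is \<open>3 * 3 * 8\<close>\<close>
proof (intro exI[of _ 72] allI impI)
  fix K :: "(real^2) set" and s1 s2 s3 :: "real^2"
  assume asm: "symmetric_convex_body K \<and> strictly_convex K \<and> \<not> collinear {s1, s2, s3}"
  then have body: "symmetric_convex_body K" by blast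
  let ?N = "body_norm K" and ?S = "integer_distance_points K s1 s2 s3"
  have N: "strictly_sublinear ?N" using asm body_norm_strictly_sublinear by blast
  have nondeg: "det2 (s2 - s1) (s3 - s1) \<noteq> 0" using asm det2_noncollinear by blast
  define d2 where "d2 = ?N (s2 - s1)"
  define d3 where "d3 = ?N (s3 - s1)"
  define I where "I = {- \<lfloor>d2\<rfloor>..\<lfloor>d2\<rfloor>} \<times> {- \<lfloor>d3\<rfloor>..\<lfloor>d3\<rfloor>}"
  define H where "H = (\<lambda>(i, j). {p. ?N (s2 - p) - ?N (s1 - p) = of_int i \<and> ?N (s3 - p) - ?N (s1 - p) = of_int j})"
  have d: "0 \<le> d2" "0 \<le> d3" unfolding d2_def d3_def using body_norm_nonneg[OF body] by auto
  have H: "finite (H ij)" "card (H ij) \<le> 8" for ij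
    using hyperbola_intersection_bound[OF N nondeg] unfolding H_def by (auto split: prod.split)
  have range: "i \<in> {- \<lfloor>d\<rfloor>..\<lfloor>d\<rfloor>}" if "\<bar>real_of_int i\<bar> \<le> d" for i d
    using that by (auto simp: le_floor_iff) linarith
  have cover: "?S \<subseteq> (\<Union>ij\<in>I. H ij)"
  proof
    fix p assume "p \<in> ?S"
    then have "?N (s1 - p) \<in> \<int>" "?N (s2 - p) \<in> \<int>" "?N (s3 - p) \<in> \<int>"
      unfolding integer_distance_points_def convex_dist_eq_body_norm by auto
    then obtain i j where ij: "?N (s2 - p) - ?N (s1 - p) = of_int i" "?N (s3 - p) - ?N (s1 - p) = of_int j"
      by (metis Ints_cases Ints_diff)
    have "\<bar>real_of_int i\<bar> \<le> d2" "\<bar>real_of_int j\<bar> \<le> d3"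
      using body_norm_diff_le[OF body, of "s2 - p" "s1 - p"] body_norm_diff_le[OF body, of "s3 - p" "s1 - p"] ij
      unfolding d2_def d3_def by auto
    then have "(i, j) \<in> I" unfolding I_def using range by blast
    moreover have "p \<in> H (i, j)" using ij unfolding H_def by simp
    ultimately show "p \<in> (\<Union>ij\<in>I. H ij)" by blast
  qed
  have finI: "finite I" unfolding I_def by simp
  then have fin: "finite (\<Union>ij\<in>I. H ij)" using H by blast
  have "card ?S \<le> (\<Sum>ij\<in>I. card (H ij))"
    using card_mono[OF fin cover] card_UN_le[OF finI, of H] by linarith
  also have "\<dots> \<le> card I * 8" using sum_bounded_above[of I "\<lambda>ij. card (H ij)" 8] H by simp
  finally have "real (card ?S) \<le> 8 * real (card I)" by simp
  also have "real (card I) = real (card {- \<lfloor>d2\<rfloor>..\<lfloor>d2\<rfloor>}) * real (card {- \<lfloor>d3\<rfloor>..\<lfloor>d3\<rfloor>})"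
    unfolding I_def card_cartesian_product by simp
  also have "8 * \<dots> \<le> 8 * ((3 * max 1 d2) * (3 * max 1 d3))"
    using card_symmetric_int_interval d by (intro mult_left_mono mult_mono) auto
  finally have "real (card ?S) \<le> 72 * (max 1 d2 * max 1 d3)" by simp
  then show "finite ?S \<and> real (card ?S) \<le> 72 * (max 1 (convex_dist K s1 s2) * max 1 (convex_dist K s1 s3))"
    using finite_subset[OF cover fin] unfolding convex_dist_eq_body_norm d2_def d3_def by blast
qed

end
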